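(* Let $K$ be a subcomplex of a finite simplicial complex $L$ and let $k\ge 0$. (1) (Birth) Let $[\alpha]_L \in \mathrm{H}^k(L)$ be a cohomology class born between $K$ and $L$. Then the set $$\operatorname*{arg\,min}_{\alpha' \in \mathrm{C}^k(L)} \left\{ \|\alpha'\|_2 \;\middle|\; \alpha'|_K = 0,\ \alpha' \in [\alpha]_L \right\}$$ consists of exactly one element. (2) (Death) Let $\beta$ be a $k$-cocycle on $K$ whose class $[\beta]_K \in \mathrm{H}^k(K)$ dies between $K$ and $L$. Then the set $$\operatorname*{arg\,min}_{\omega\in \mathrm{C}^{k+1}(L)} \left\{ \|\omega\|_2 \;\middle|\; \omega = \delta_L^k\beta' \text{ for some } \beta' \in \mathrm{C}^k(L) \text{ with } \beta'|_K = \beta \right\}$$ consists of exactly one element; i.e. the cochain $\delta_L^k\hat\beta$ is the same for every minimizer $\hat\beta$ of $\|\delta_L^k\beta'\|_2$ over all $\beta' \in \mathrm{C}^k(L)$ with $\beta'|_K=\beta$.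
   Context: All simplicial complexes are finite and all (co)homology has real coefficients. $\mathrm{C}^k(X)$ is the space of real-valued functions on the set of $k$-simplices of $X$ (with orientations fixed), with inner product $\langle\alpha,\beta\rangle=\sum_\sigma \alpha(\sigma)\beta(\sigma)$ and norm $\|\cdot\|_2$. $\delta_X^k:\mathrm{C}^k(X)\to \mathrm{C}^{k+1}(X)$ is the coboundary operator and $\mathrm{H}^k(X)=\ker\delta_X^k/\operatorname{im}\delta_X^{k-1}$ (with $\delta^{-1}_X=0$). For a cocycle $\alpha$, $[\alpha]_X$ is its cohomology class, regarded also as a set of cocycles. For $\varphi\in \mathrm{C}^k(L)$, $\varphi|_K$ is its restriction to the $k$-simplices of $K$. A class $[\alpha]_L\in \mathrm{H}^k(L)$ is born between $K$ and $L$ if $[\alpha|_K]=0\in \mathrm{H}^k(K)$. A class $[\beta]_K\in \mathrm{H}^k(K)$ dies between $K$ and $L$ if $\beta$ cannot be extended to a $k$-cocycle on $L$. *)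

theory Defs
  imports Complex_Main "HOL-Combinatorics.Permutations"
begin

section \<open>Finite simplicial complexes\<close>

definition finite_simplicial_complex :: "'a set set \<Rightarrow> bool" where
  "finite_simplicial_complex X \<longleftrightarrow>
     finite X \<and>
     (\<forall>\<sigma>\<in>X. finite \<sigma> \<and> \<sigma> \<noteq> {}) \<and>
     (\<forall>\<sigma>\<in>X. \<forall>\<tau>. \<tau> \<noteq> {} \<longrightarrow> \<tau> \<subseteq> \<sigma> \<longrightarrow> \<tau> \<in> X)"

definition subcomplex :: "'a set set \<Rightarrow> 'a set set \<Rightarrow> bool" where
  "subcomplex K L \<longleftrightarrow>
     finite_simplicial_complex K \<and> finite_simplicial_complex L \<and> K \<subseteq> L"

definition simplices :: "'a set set \<Rightarrow> nat \<Rightarrow> 'a set set" where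
  "simplices X k = {\<sigma> \<in> X. card \<sigma> = Suc k}"

section \<open>Orientations\<close>

text \<open>An orientation is given by choosing, for every simplex, an ordering of its vertices as a
  list; only the class of this list modulo even permutations matters. A subcomplex inherits the
  orientations of its simplices.\<close>

definition orientation :: "'a set set \<Rightarrow> ('a set \<Rightarrow> 'a list) \<Rightarrow> bool" where
  "orientation X ori \<longleftrightarrow> (\<forall>\<sigma>\<in>X. distinct (ori \<sigma>) \<and> set (ori \<sigma>) = \<sigma>)"

text \<open>The sign of the permutation of positions that turns \<open>xs\<close> into \<open>ys\<close>. It is meaningful
  when both lists are distinct and have the same elements; that permutation is then unique.\<close>

definition reorder_sign :: "'a list \<Rightarrow> 'a list \<Rightarrow> real" where
  "reorder_sign xs ys =
     of_int (sign (THE p. p permutes {..<length xs} \<and> permute_list p xs = ys))"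

section \<open>Cochains and cohomology\<close>

text \<open>A cochain is a function on the \<open>k\<close>-simplices, represented by its extension by zero.\<close>

definition cochains :: "'a set set \<Rightarrow> nat \<Rightarrow> ('a set \<Rightarrow> real) set" where
  "cochains X k = {\<alpha>. \<forall>\<sigma>. \<sigma> \<notin> simplices X k \<longrightarrow> \<alpha> \<sigma> = 0}"

definition restrict_cochain :: "'a set set \<Rightarrow> nat \<Rightarrow> ('a set \<Rightarrow> real) \<Rightarrow> 'a set \<Rightarrow> real" where
  "restrict_cochain K k \<phi> = (\<lambda>\<sigma>. if \<sigma> \<in> simplices K k then \<phi> \<sigma> else 0)"

definition cochain_inner ::
    "'a set set \<Rightarrow> nat \<Rightarrow> ('a set \<Rightarrow> real) \<Rightarrow> ('a set \<Rightarrow> real) \<Rightarrow> real" where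
  "cochain_inner X k \<alpha> \<beta> = (\<Sum>\<sigma>\<in>simplices X k. \<alpha> \<sigma> * \<beta> \<sigma>)"

definition cochain_norm :: "'a set set \<Rightarrow> nat \<Rightarrow> ('a set \<Rightarrow> real) \<Rightarrow> real" where
  "cochain_norm X k \<alpha> = sqrt (cochain_inner X k \<alpha> \<alpha>)"

text \<open>Value of a cochain on the oriented simplex \<open>[x\<^sub>0, \<dots>, x\<^sub>k]\<close> whose orientation need not be
  the chosen one.\<close>

definition cochain_eval ::
    "('a set \<Rightarrow> 'a list) \<Rightarrow> ('a set \<Rightarrow> real) \<Rightarrow> 'a list \<Rightarrow> real" where
  "cochain_eval ori \<alpha> xs = reorder_sign (ori (set xs)) xs * \<alpha> (set xs)"

definition omit_nth :: "nat \<Rightarrow> 'a list \<Rightarrow> 'a list" where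
  "omit_nth i xs = take i xs @ drop (Suc i) xs"

definition coboundary ::
    "('a set \<Rightarrow> 'a list) \<Rightarrow> 'a set set \<Rightarrow> nat \<Rightarrow> ('a set \<Rightarrow> real) \<Rightarrow> 'a set \<Rightarrow> real" where
  "coboundary ori X k \<alpha> =
     (\<lambda>\<sigma>. if \<sigma> \<in> simplices X (Suc k)
          then \<Sum>i\<le>Suc k. (-1) ^ i * cochain_eval ori \<alpha> (omit_nth i (ori \<sigma>))
          else 0)"

definition cocycles :: "('a set \<Rightarrow> 'a list) \<Rightarrow> 'a set set \<Rightarrow> nat \<Rightarrow> ('a set \<Rightarrow> real) set" where
  "cocycles ori X k = {\<alpha> \<in> cochains X k. coboundary ori X k \<alpha> = (\<lambda>_. 0)}"

text \<open>The case \<open>k = 0\<close> is the image of the zero map in degree \<open>-1\<close>.\<close>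

definition coboundaries :: "('a set \<Rightarrow> 'a list) \<Rightarrow> 'a set set \<Rightarrow> nat \<Rightarrow> ('a set \<Rightarrow> real) set" where
  "coboundaries ori X k =
     (case k of 0 \<Rightarrow> {\<lambda>_. 0} | Suc j \<Rightarrow> coboundary ori X j ` cochains X j)"

text \<open>The cohomology space is the quotient of the cocycles by this relation.\<close>

definition cohomologous ::
    "('a set \<Rightarrow> 'a list) \<Rightarrow> 'a set set \<Rightarrow> nat \<Rightarrow> (('a set \<Rightarrow> real) \<times> ('a set \<Rightarrow> real)) set" where
  "cohomologous ori X k =
     {(\<alpha>, \<alpha>'). \<alpha> \<in> cocycles ori X k \<and> \<alpha>' \<in> cocycles ori X k \<and>
               (\<lambda>\<sigma>. \<alpha>' \<sigma> - \<alpha> \<sigma>) \<in> coboundaries ori X k}"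

definition cohom_class ::
    "('a set \<Rightarrow> 'a list) \<Rightarrow> 'a set set \<Rightarrow> nat \<Rightarrow> ('a set \<Rightarrow> real) \<Rightarrow> ('a set \<Rightarrow> real) set" where
  "cohom_class ori X k \<alpha> = cohomologous ori X k `` {\<alpha>}"

section \<open>Birth and death\<close>

definition born_between ::
    "('a set \<Rightarrow> 'a list) \<Rightarrow> 'a set set \<Rightarrow> 'a set set \<Rightarrow> nat \<Rightarrow> ('a set \<Rightarrow> real) \<Rightarrow> bool" where
  "born_between ori K L k \<alpha> \<longleftrightarrow>
     \<alpha> \<in> cocycles ori L k \<and>
     cohom_class ori K k (restrict_cochain K k \<alpha>) = cohom_class ori K k (\<lambda>_. 0)"

definition dies_between ::
    "('a set \<Rightarrow> 'a list) \<Rightarrow> 'a set set \<Rightarrow> 'a set set \<Rightarrow> nat \<Rightarrow> ('a set \<Rightarrow> real) \<Rightarrow> bool" where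
  "dies_between ori K L k \<beta> \<longleftrightarrow>
     \<beta> \<in> cocycles ori K k \<and>
     \<not> (\<exists>\<beta>'\<in>cocycles ori L k. restrict_cochain K k \<beta>' = \<beta>)"

definition arg_min_set :: "('b \<Rightarrow> real) \<Rightarrow> 'b set \<Rightarrow> 'b set" where
  "arg_min_set f S = {x. is_arg_min f (\<lambda>x. x \<in> S) x}"

end

theory Submission
  imports Defs
begin

text \<open>Both feasible sets are affine subspaces of a finite-dimensional inner product space, and a
  nonempty one has a unique point of least norm, the orthogonal projection of the origin. For death,
  extending \<open>\<beta>\<close> by zero shows nonemptiness. For birth, write the restriction of \<open>\<alpha>\<close> to \<open>K\<close> as
  the coboundary of a cochain \<open>\<gamma>\<close> on \<open>K\<close>, extend \<open>\<gamma>\<close> by zero and subtract its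
  coboundary on \<open>L\<close>; the result is a cocycle because the coboundary operator squares to zero.\<close>

section \<open>Signs of reorderings\<close>

text \<open>Distinctness makes positions recoverable from entries. This uniqueness is what makes the
  \<open>THE\<close> in \<open>reorder_sign\<close> denote a definite permutation.\<close>

lemma permute_list_inject:
  assumes "distinct xs" "p permutes {..<length xs}" "q permutes {..<length xs}"
    and "permute_list p xs = permute_list q xs"
  shows "p = q"
proof
  fix i
  show "p i = q i"
  proof (cases "i < length xs")
    case True
    then have "xs ! p i = xs ! q i"
      using assms(4) permute_list_nth[OF assms(2) True] permute_list_nth[OF assms(3) True] by simp
    moreover have "p i < length xs" "q i < length xs"
      using True permutes_in_image[OF assms(2)] permutes_in_image[OF assms(3)] by auto
    ultimately show ?thesis using assms(1) by (simp add: nth_eq_iff_index_eq)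
  next
    case False
    then show ?thesis using assms(2,3) by (simp add: permutes_not_in)
  qed
qed

text \<open>The evaluation rule for \<open>reorder_sign\<close>: exhibiting one permutation of
  positions that does the reordering suffices, since it is the only one.\<close>

lemma reorder_sign_permute_list:
  assumes "distinct xs" "p permutes {..<length xs}"
  shows "reorder_sign xs (permute_list p xs) = of_int (sign p)"
proof -
  have "(THE q. q permutes {..<length xs} \<and> permute_list q xs = permute_list p xs) = p"
    using assms permute_list_inject by (intro the_equality) blast+
  then show ?thesis by (simp add: reorder_sign_def)
qed

lemma distinct_reordering:
  assumes "distinct xs" "distinct ys" "set xs = set ys"
  obtains p where "p permutes {..<length xs}" "ys = permute_list p xs"
  using mset_eq_permutation[of ys xs] assms set_eq_iff_mset_eq_distinct[of xs ys] by metis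

text \<open>The permutations of positions compose and \<open>sign\<close> is multiplicative, so a
  reordering may be routed through any intermediate ordering.\<close>

lemma reorder_sign_trans:
  assumes "distinct xs" "distinct ys" "distinct zs" "set xs = set ys" "set ys = set zs"
  shows "reorder_sign xs ys * reorder_sign ys zs = reorder_sign xs zs"
proof -
  obtain p where p: "p permutes {..<length xs}" "ys = permute_list p xs"
    using assms distinct_reordering by metis
  obtain q where q: "q permutes {..<length ys}" "zs = permute_list q ys"
    using assms distinct_reordering by metis
  have q': "q permutes {..<length xs}" using q p by simp
  have "zs = permute_list (p \<circ> q) xs"
    using p q permute_list_compose[OF q'] by simp
  moreover have "sign (p \<circ> q) = sign p * sign q"
    using p q' by (intro sign_compose) (auto intro: permutes_imp_permutation)
  ultimately show ?thesis
    using reorder_sign_permute_list[OF assms(1) p(1)] reorder_sign_permute_list[OF assms(2) q(1)]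
      reorder_sign_permute_list[OF assms(1) permutes_compose[OF q' p(1)]] p(2) q(2)
    by simp
qed

text \<open>A common head is a fixed position 0: the permutation of the tails, transported along
  \<open>Suc\<close>, does the reordering and keeps its sign.\<close>

lemma reorder_sign_Cons:
  assumes "distinct (x # xs)" "distinct ys" "set xs = set ys"
  shows "reorder_sign (x # xs) (x # ys) = reorder_sign xs ys"
proof -
  let ?n = "length xs"
  obtain p where p: "p permutes {..<?n}" "ys = permute_list p xs"
    using assms distinct_reordering by (metis distinct.simps(2))
  define q where "q = map_permutation {..<?n} Suc p"
  have "bij_betw Suc {..<?n} {1..<Suc ?n}"
    by (simp add: bij_betw_def lessThan_atLeast0 image_Suc_atLeastLessThan)
  then have q1: "q permutes {1..<Suc ?n}"
    unfolding q_def using p(1) by (rule map_permutation_permutes)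
  then have q: "q permutes {..<Suc ?n}"
    by (rule permutes_subset) auto
  have qS: "q (Suc i) = Suc (p i)" if "i < ?n" for i
    unfolding q_def using that by (intro map_permutation_apply) auto
  have q0: "q 0 = 0" using q1 by (simp add: permutes_not_in)
  have "permute_list q (x # xs) = x # ys"
    using p(2) q0 qS by (auto simp: permute_list_def upt_conv_Cons map_Suc_upt[symmetric] simp del: upt_Suc)
  moreover have "sign q = sign p"
    unfolding q_def using p(1) by (intro sign_map_permutation) auto
  ultimately show ?thesis
    using reorder_sign_permute_list[OF assms(1), of q] reorder_sign_permute_list[of xs p]
      assms(1) p q by simp
qed

lemma reorder_sign_swap:
  assumes "distinct (x # y # zs)"
  shows "reorder_sign (x # y # zs) (y # x # zs) = -1"
proof -
  let ?t = "Transposition.transpose 0 (Suc 0)"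
  have t: "?t permutes {..<length (x # y # zs)}"
    by (intro permutes_swap_id) auto
  have "permute_list ?t (x # y # zs) = y # x # zs"
    by (rule nth_equalityI)
      (auto simp: permute_list_nth[OF t] nth_Cons transpose_def split: nat.split)
  then show ?thesis
    using reorder_sign_permute_list[OF assms t] by (simp add: sign_swap_id)
qed

section \<open>Bringing a chosen entry to the front\<close>

lemma set_omit_nth:
  assumes "distinct xs" "i < length xs"
  shows "set (omit_nth i xs) = set xs - {xs ! i}" and "distinct (omit_nth i xs)"
proof -
  have "distinct (take i xs @ xs ! i # drop (Suc i) xs)"
    using assms id_take_nth_drop by metis
  moreover have "set xs = set (take i xs @ xs ! i # drop (Suc i) xs)"
    using assms id_take_nth_drop by metis
  ultimately show "set (omit_nth i xs) = set xs - {xs ! i}" "distinct (omit_nth i xs)"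
    by (auto simp: omit_nth_def)
qed

text \<open>Each entry that is passed costs one adjacent swap. In the induction the entry is first
  brought to the front of the tail, then exchanged with the head; this links the sign
  \<open>(-1) ^ i\<close> of the coboundary formula to \<open>reorder_sign\<close>.\<close>

lemma reorder_sign_nth_first:
  assumes "distinct xs" "i < length xs"
  shows "reorder_sign xs (xs ! i # omit_nth i xs) = (-1) ^ i"
  using assms
proof (induction xs arbitrary: i)
  case (Cons x xs)
  show ?case
  proof (cases i)
    case 0
    then show ?thesis
      using reorder_sign_permute_list[OF Cons.prems(1) permutes_id]
      by (simp add: omit_nth_def)
  next
    case (Suc j)
    let ?y = "xs ! j" and ?zs = "omit_nth j xs"
    have j: "j < length xs" "distinct xs" "x \<notin> set xs" using Cons.prems Suc by auto
    note zs = set_omit_nth[OF j(2,1)]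
    have y: "?y \<in> set xs" using j by simp
    have d: "distinct (?y # ?zs)" and S: "set xs = set (?y # ?zs)"
      unfolding list.set zs(1) distinct.simps using zs(2) y by blast+
    then have d': "distinct (x # ?y # ?zs)" using j(3) by simp
    have "reorder_sign (x # xs) (x # ?y # ?zs) = (-1) ^ j"
      using reorder_sign_Cons[OF Cons.prems(1) d S] Cons.IH[OF j(2,1)] by simp
    moreover have "reorder_sign (x # ?y # ?zs) (?y # x # ?zs) = -1"
      using d' by (rule reorder_sign_swap)
    moreover have "reorder_sign (x # xs) (x # ?y # ?zs) * reorder_sign (x # ?y # ?zs) (?y # x # ?zs)
        = reorder_sign (x # xs) (?y # x # ?zs)"
    proof (rule reorder_sign_trans[OF Cons.prems(1) d'])
      show "distinct (?y # x # ?zs)" using d' by (simp only: distinct.simps list.set) blast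
      show "set (x # xs) = set (x # ?y # ?zs)" by (simp only: list.set S)
      show "set (x # ?y # ?zs) = set (?y # x # ?zs)" by (simp only: list.set insert_commute)
    qed
    ultimately show ?thesis using Suc by (simp add: omit_nth_def)
  qed
qed simp

section \<open>The coboundary operator\<close>

lemma simplices_face:
  assumes "finite_simplicial_complex X" "\<sigma> \<in> simplices X (Suc k)" "v \<in> \<sigma>"
  shows "\<sigma> - {v} \<in> simplices X k"
proof -
  have \<sigma>: "\<sigma> \<in> X" "card \<sigma> = Suc (Suc k)" using assms by (auto simp: simplices_def)
  then have c: "card (\<sigma> - {v}) = Suc k" using assms(3) by simp
  then have "\<sigma> - {v} \<noteq> {}" by (metis card.empty nat.distinct(1))
  then have "\<sigma> - {v} \<in> X"
    using assms(1) \<sigma>(1) unfolding finite_simplicial_complex_def by (metis Diff_subset)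
  then show ?thesis using c by (simp add: simplices_def)
qed

lemma orientation_simplex:
  assumes "orientation X ori" "\<sigma> \<in> simplices X k"
  shows "distinct (ori \<sigma>)" "set (ori \<sigma>) = \<sigma>"
  using assms by (auto simp: orientation_def simplices_def)

text \<open>The position of a vertex in the chosen ordering is absorbed into the sign of moving that
  vertex to the front.\<close>

lemma coboundary_eq_sum_vertices:
  assumes "finite_simplicial_complex X" "orientation X ori" "\<sigma> \<in> simplices X (Suc k)"
  shows "coboundary ori X k \<alpha> \<sigma>
    = (\<Sum>v\<in>\<sigma>. reorder_sign (ori \<sigma>) (v # ori (\<sigma> - {v})) * \<alpha> (\<sigma> - {v}))"
proof -
  let ?xs = "ori \<sigma>"
  note xs = orientation_simplex[OF assms(2,3)]
  have len: "length ?xs = Suc (Suc k)"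
    using xs assms(3) distinct_card[of ?xs] by (simp add: simplices_def)
  let ?g = "\<lambda>v. reorder_sign ?xs (v # ori (\<sigma> - {v})) * \<alpha> (\<sigma> - {v})"
  have term_eq: "(-1) ^ i * cochain_eval ori \<alpha> (omit_nth i ?xs) = ?g (?xs ! i)"
    if "i \<in> {..Suc k}" for i
  proof -
    define v where "v = ?xs ! i"
    define zs where "zs = omit_nth i ?xs"
    define ys where "ys = ori (\<sigma> - {v})"
    have i: "i < length ?xs" using that len by simp
    then have v: "v \<in> \<sigma>" unfolding v_def using xs nth_mem by metis
    have zs: "distinct zs" "set zs = \<sigma> - {v}"
      using set_omit_nth[OF xs(1) i] xs(2) by (simp_all add: zs_def v_def)
    have ys: "distinct ys" "set ys = \<sigma> - {v}"
      using orientation_simplex[OF assms(2) simplices_face[OF assms(1,3) v]] by (simp_all add: ys_def)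
    have dist: "distinct (v # ys)" "distinct (v # zs)" using ys zs by simp_all
    have sets: "set ?xs = set (v # ys)" "set (v # ys) = set (v # zs)"
      using ys zs xs v by auto
    \<comment> \<open>\<open>ys\<close> and \<open>zs\<close> order the same face: \<open>ys\<close>
      by its chosen orientation, \<open>zs\<close> as inherited from \<open>ori \<sigma>\<close>.
      Passing through \<open>v # ys\<close> separates the two signs.\<close>
    have "reorder_sign ?xs (v # ys) * reorder_sign (v # ys) (v # zs) = reorder_sign ?xs (v # zs)"
      by (rule reorder_sign_trans[OF xs(1) dist sets])
    moreover have "reorder_sign (v # ys) (v # zs) = reorder_sign ys zs"
      using dist(1) zs(1) by (rule reorder_sign_Cons) (simp add: ys zs)
    moreover have "reorder_sign ?xs (v # zs) = (-1) ^ i"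
      unfolding v_def zs_def using xs(1) i by (rule reorder_sign_nth_first)
    ultimately have prod: "(-1) ^ i = reorder_sign ?xs (v # ys) * reorder_sign ys zs"
      by simp
    obtain p where p: "p permutes {..<length ys}" "zs = permute_list p ys"
      using distinct_reordering[OF ys(1) zs(1)] ys(2) zs(2) by metis
    \<comment> \<open>A sign is its own inverse, so the factor introduced by
      \<open>cochain_eval\<close> cancels the one in \<open>prod\<close>.\<close>
    have sq: "reorder_sign ys zs * reorder_sign ys zs = 1"
      unfolding p(2) reorder_sign_permute_list[OF ys(1) p(1)] of_int_mult[symmetric] by simp
    have "(-1) ^ i * reorder_sign ys zs = reorder_sign ?xs (v # ys)"
      unfolding prod mult.assoc sq by simp
    moreover have "cochain_eval ori \<alpha> zs = reorder_sign ys zs * \<alpha> (\<sigma> - {v})"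
      by (simp add: cochain_eval_def ys_def zs)
    ultimately have "(-1) ^ i * cochain_eval ori \<alpha> zs = reorder_sign ?xs (v # ys) * \<alpha> (\<sigma> - {v})"
      by (metis mult.assoc)
    then show ?thesis unfolding v_def zs_def ys_def .
  qed
  have bij: "bij_betw ((!) ?xs) {..Suc k} \<sigma>"
    using xs len by (intro bij_betw_nth) auto
  have "coboundary ori X k \<alpha> \<sigma>
      = (\<Sum>i\<le>Suc k. (-1) ^ i * cochain_eval ori \<alpha> (omit_nth i ?xs))"
    using assms(3) by (simp only: coboundary_def if_True)
  also have "\<dots> = (\<Sum>i\<le>Suc k. ?g (?xs ! i))"
    by (rule sum.cong[OF refl term_eq])
  also have "\<dots> = sum ?g \<sigma>"
    by (rule sum.reindex_bij_betw[OF bij])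
  finally show ?thesis .
qed

lemma coboundary_in_cochains: "coboundary ori X k \<alpha> \<in> cochains X (Suc k)"
  by (simp add: cochains_def coboundary_def)

text \<open>Linearity in the shape needed later: feasible sets are affine, and closure under
  \<open>x + c * (y - z)\<close> is the form in which this is used throughout.\<close>

lemma coboundary_affine:
  "coboundary ori X k (\<lambda>\<sigma>. \<alpha> \<sigma> + c * (\<beta> \<sigma> - \<gamma> \<sigma>))
    = (\<lambda>\<sigma>. coboundary ori X k \<alpha> \<sigma> + c * (coboundary ori X k \<beta> \<sigma> - coboundary ori X k \<gamma> \<sigma>))"
  by (auto simp: coboundary_def cochain_eval_def algebra_simps sum.distrib sum_subtractf
      sum_distrib_left)

lemma coboundary_zero: "coboundary ori X k (\<lambda>_. 0) = (\<lambda>_. 0)"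
  by (auto simp: coboundary_def cochain_eval_def)

text \<open>Applying the vertex formula twice gives a sum over ordered pairs of distinct vertices.
  The term of \<open>(v, w)\<close> carries the sign of the ordering that starts with
  \<open>v\<close>, \<open>w\<close>; exchanging them reverses the sign but leaves the remaining
  face unchanged.\<close>

lemma coboundary_coboundary:
  assumes X: "finite_simplicial_complex X" and ori: "orientation X ori"
  shows "coboundary ori X (Suc k) (coboundary ori X k \<alpha>) = (\<lambda>_. 0)"
proof
  fix \<sigma>
  show "coboundary ori X (Suc k) (coboundary ori X k \<alpha>) \<sigma> = 0"
  proof (cases "\<sigma> \<in> simplices X (Suc (Suc k))")
    case \<sigma>: True
    then have fin: "finite \<sigma>" using X by (auto simp: simplices_def finite_simplicial_complex_def)
    note xs = orientation_simplex[OF ori \<sigma>]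
    define g where "g v w = reorder_sign (ori \<sigma>) (v # w # ori (\<sigma> - {v} - {w})) * \<alpha> (\<sigma> - {v} - {w})"
      for v w
    define D where "D = Sigma \<sigma> (\<lambda>v. \<sigma> - {v})"
    have face: "distinct (ori (\<sigma> - {v} - {w}))" "set (ori (\<sigma> - {v} - {w})) = \<sigma> - {v} - {w}"
      "distinct (ori (\<sigma> - {v}))" "set (ori (\<sigma> - {v})) = \<sigma> - {v}"
      if "v \<in> \<sigma>" "w \<in> \<sigma> - {v}" for v w
      using orientation_simplex[OF ori simplices_face[OF X simplices_face[OF X \<sigma> that(1)] that(2)]]
        orientation_simplex[OF ori simplices_face[OF X \<sigma> that(1)]] by auto
    have "reorder_sign (ori \<sigma>) (v # ori (\<sigma> - {v})) * coboundary ori X k \<alpha> (\<sigma> - {v})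
        = (\<Sum>w\<in>\<sigma> - {v}. g v w)" if v: "v \<in> \<sigma>" for v
    proof -
      have "reorder_sign (ori \<sigma>) (v # ori (\<sigma> - {v}))
          * reorder_sign (ori (\<sigma> - {v})) (w # ori (\<sigma> - {v} - {w}))
          = reorder_sign (ori \<sigma>) (v # w # ori (\<sigma> - {v} - {w}))" if w: "w \<in> \<sigma> - {v}" for w
      proof -
        note f = face[OF v w]
        have "reorder_sign (v # ori (\<sigma> - {v})) (v # w # ori (\<sigma> - {v} - {w}))
            = reorder_sign (ori (\<sigma> - {v})) (w # ori (\<sigma> - {v} - {w}))"
          using f w by (intro reorder_sign_Cons) auto
        moreover have "reorder_sign (ori \<sigma>) (v # ori (\<sigma> - {v}))
            * reorder_sign (v # ori (\<sigma> - {v})) (v # w # ori (\<sigma> - {v} - {w}))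
            = reorder_sign (ori \<sigma>) (v # w # ori (\<sigma> - {v} - {w}))"
          using f v w xs by (intro reorder_sign_trans) auto
        ultimately show ?thesis by simp
      qed
      then show ?thesis
        using coboundary_eq_sum_vertices[OF X ori simplices_face[OF X \<sigma> v], of \<alpha>]
        by (simp add: g_def sum_distrib_left flip: mult.assoc)
    qed
    then have sum: "coboundary ori X (Suc k) (coboundary ori X k \<alpha>) \<sigma> = (\<Sum>(v, w)\<in>D. g v w)"
      unfolding coboundary_eq_sum_vertices[OF X ori \<sigma>] D_def using fin by (simp add: sum.Sigma)
    have anti: "g w v = - g v w" if "(v, w) \<in> D" for v w
    proof -
      have v: "v \<in> \<sigma>" "w \<in> \<sigma> - {v}" using that by (auto simp: D_def)
      note f = face[OF v]
      have sw: "\<sigma> - {w} - {v} = \<sigma> - {v} - {w}" by auto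
      have "reorder_sign (v # w # ori (\<sigma> - {v} - {w})) (w # v # ori (\<sigma> - {v} - {w})) = -1"
        using f v by (intro reorder_sign_swap) auto
      moreover have "reorder_sign (ori \<sigma>) (v # w # ori (\<sigma> - {v} - {w}))
          * reorder_sign (v # w # ori (\<sigma> - {v} - {w})) (w # v # ori (\<sigma> - {v} - {w}))
          = reorder_sign (ori \<sigma>) (w # v # ori (\<sigma> - {v} - {w}))"
        using f v xs by (intro reorder_sign_trans) auto
      ultimately have "reorder_sign (ori \<sigma>) (w # v # ori (\<sigma> - {v} - {w}))
          = - reorder_sign (ori \<sigma>) (v # w # ori (\<sigma> - {v} - {w}))" by simp
      then show ?thesis by (simp add: g_def sw)
    qed
    \<comment> \<open>\<open>D\<close> is symmetric, so with \<open>anti\<close> the sum equals its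
      own negative and vanishes.\<close>
    have "(\<Sum>(v, w)\<in>D. g v w) = (\<Sum>(v, w)\<in>D. g w v)"
      by (rule sum.reindex_bij_witness[of _ prod.swap prod.swap]) (auto simp: D_def)
    also have "\<dots> = - (\<Sum>(v, w)\<in>D. g v w)"
      unfolding sum_negf[symmetric] using anti by (intro sum.cong) auto
    finally show ?thesis using sum by simp
  qed (simp add: coboundary_def)
qed

section \<open>Points of least norm\<close>

text \<open>Induction on the support: split off a vector that does not vanish at the new point, made
  orthogonal to the subspace of those that do.\<close>

lemma orthogonal_projection_exists:
  fixes V :: "('b \<Rightarrow> real) set" and a :: "'b \<Rightarrow> real"
  assumes "finite A" "V \<noteq> {}" "\<forall>v\<in>V. \<forall>\<sigma>. \<sigma> \<notin> A \<longrightarrow> v \<sigma> = 0"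
    and "\<forall>v\<in>V. \<forall>w\<in>V. \<forall>c. (\<lambda>\<sigma>. v \<sigma> + c * w \<sigma>) \<in> V"
  shows "\<exists>v\<in>V. \<forall>w\<in>V. (\<Sum>\<sigma>\<in>A. (a \<sigma> - v \<sigma>) * w \<sigma>) = 0"
  using assms
proof (induction A arbitrary: V a)
  case empty
  then show ?case by auto
next
  case (insert x A)
  define V0 where "V0 = {v\<in>V. v x = 0}"
  obtain v0 where v0: "v0 \<in> V" using insert.prems by blast
  \<comment> \<open>This is the zero function, which witnesses that \<open>V0\<close> is
    nonempty.\<close>
  have "(\<lambda>\<sigma>. v0 \<sigma> + (-1) * v0 \<sigma>) \<in> V" using insert.prems v0 by blast
  then have ne: "V0 \<noteq> {}" by (auto simp: V0_def intro!: exI[of _ "\<lambda>_. 0"])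
  have supp: "\<forall>v\<in>V0. \<forall>\<sigma>. \<sigma> \<notin> A \<longrightarrow> v \<sigma> = 0"
    using insert.prems(2) by (auto simp: V0_def)
  have sub: "\<forall>v\<in>V0. \<forall>w\<in>V0. \<forall>c. (\<lambda>\<sigma>. v \<sigma> + c * w \<sigma>) \<in> V0"
    using insert.prems(3) by (auto simp: V0_def)
  \<comment> \<open>Test vectors in \<open>V0\<close> vanish at \<open>x\<close>, so the sums over
    \<open>A\<close> and \<open>insert x A\<close> agree. Keeping \<open>b\<close> arbitrary allows
    projecting both \<open>u\<close> and \<open>a\<close>.\<close>
  have proj: "\<exists>v\<in>V0. \<forall>w\<in>V0. (\<Sum>\<sigma>\<in>insert x A. (b \<sigma> - v \<sigma>) * w \<sigma>) = 0" for b
  proof -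
    obtain v where v: "v \<in> V0" "\<forall>w\<in>V0. (\<Sum>\<sigma>\<in>A. (b \<sigma> - v \<sigma>) * w \<sigma>) = 0"
      using insert.IH[OF ne supp sub] by blast
    then show ?thesis
      using insert.hyps by (intro bexI[of _ v]) (auto simp: V0_def)
  qed
  show ?case
  proof (cases "V = V0")
    case True
    then show ?thesis using proj by simp
  next
    case False
    then obtain u where u: "u \<in> V" "u x \<noteq> 0" by (auto simp: V0_def)
    obtain p where p: "p \<in> V0" "\<forall>w\<in>V0. (\<Sum>\<sigma>\<in>insert x A. (u \<sigma> - p \<sigma>) * w \<sigma>) = 0"
      using proj by blast
    obtain q where q: "q \<in> V0" "\<forall>w\<in>V0. (\<Sum>\<sigma>\<in>insert x A. (a \<sigma> - q \<sigma>) * w \<sigma>) = 0"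
      using proj by blast
    \<comment> \<open>\<open>V\<close> is the orthogonal sum of \<open>V0\<close> and the line
      through \<open>e\<close>. The projection of \<open>a\<close> is therefore \<open>q\<close>
      plus its component \<open>c * e\<close> along that line.\<close>
    define e where "e \<sigma> = u \<sigma> - p \<sigma>" for \<sigma>
    define N where "N = (\<Sum>\<sigma>\<in>insert x A. e \<sigma> * e \<sigma>)"
    define c where "c = (\<Sum>\<sigma>\<in>insert x A. a \<sigma> * e \<sigma>) / N"
    have pq: "p x = 0" "q x = 0" "p \<in> V" "q \<in> V" using p q by (auto simp: V0_def)
    have ex: "e x \<noteq> 0" using u pq by (simp add: e_def)
    have "(\<lambda>\<sigma>. u \<sigma> + (-1) * p \<sigma>) \<in> V" using insert.prems(3) u pq by blast
    then have e: "e \<in> V" by (simp add: e_def[abs_def])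
    have N: "N > 0" unfolding N_def
      using ex insert.hyps by (intro sum_pos2[of _ x]) (auto simp: zero_less_mult_iff)
    have eo: "(\<Sum>\<sigma>\<in>insert x A. e \<sigma> * w \<sigma>) = 0" if "w \<in> V0" for w
      using p that by (simp add: e_def)
    show ?thesis
    proof (intro bexI[of _ "\<lambda>\<sigma>. q \<sigma> + c * e \<sigma>"] ballI)
      show "(\<lambda>\<sigma>. q \<sigma> + c * e \<sigma>) \<in> V" using insert.prems(3) pq e by blast
      fix w assume w: "w \<in> V"
      define d where "d = w x / e x"
      \<comment> \<open>The scalar \<open>d\<close> is chosen so that \<open>r\<close> vanishes at
        \<open>x\<close>; thus \<open>w = r + d * e\<close> splits the test vector along the
        orthogonal sum.\<close>
      define r where "r \<sigma> = w \<sigma> - d * e \<sigma>" for \<sigma>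
      have "(\<lambda>\<sigma>. w \<sigma> + (- d) * e \<sigma>) \<in> V" using insert.prems(3) w e by blast
      then have r: "r \<in> V0" using ex by (simp add: V0_def r_def[abs_def] d_def)
      have "(\<Sum>\<sigma>\<in>insert x A. (a \<sigma> - (q \<sigma> + c * e \<sigma>)) * w \<sigma>)
          = (\<Sum>\<sigma>\<in>insert x A. (a \<sigma> - q \<sigma>) * r \<sigma> - c * (e \<sigma> * r \<sigma>)
              + d * (a \<sigma> * e \<sigma>) - d * (e \<sigma> * q \<sigma>) - d * c * (e \<sigma> * e \<sigma>))"
        by (intro sum.cong) (auto simp: r_def algebra_simps)
      also have "\<dots> = (\<Sum>\<sigma>\<in>insert x A. (a \<sigma> - q \<sigma>) * r \<sigma>) - c * (\<Sum>\<sigma>\<in>insert x A. e \<sigma> * r \<sigma>)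
          + d * (\<Sum>\<sigma>\<in>insert x A. a \<sigma> * e \<sigma>) - d * (\<Sum>\<sigma>\<in>insert x A. e \<sigma> * q \<sigma>) - d * c * N"
        unfolding N_def by (simp only: sum.distrib sum_subtractf sum_distrib_left)
      also have "\<dots> = 0"
        using eo[OF r] eo[OF q(1)] q(2) r N by (simp add: c_def del: sum.insert)
      finally show "(\<Sum>\<sigma>\<in>insert x A. (a \<sigma> - (q \<sigma> + c * e \<sigma>)) * w \<sigma>) = 0" .
    qed
  qed
qed

text \<open>The minimizer is the point of \<open>S\<close> orthogonal to all directions of
  \<open>S\<close>; Pythagoras then gives both minimality and uniqueness.\<close>

lemma affine_arg_min_norm_singleton:
  assumes X: "finite_simplicial_complex X" and S: "S \<subseteq> cochains X k" "S \<noteq> {}"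
    and aff: "\<And>x y z c. x \<in> S \<Longrightarrow> y \<in> S \<Longrightarrow> z \<in> S \<Longrightarrow> (\<lambda>\<sigma>. x \<sigma> + c * (y \<sigma> - z \<sigma>)) \<in> S"
  shows "is_singleton (arg_min_set (cochain_norm X k) S)"
proof -
  let ?A = "simplices X k"
  have fin: "finite ?A" using X by (simp add: simplices_def finite_simplicial_complex_def)
  obtain a where a: "a \<in> S" using S by blast
  \<comment> \<open>The direction space of \<open>S\<close>. Projecting \<open>- a\<close> onto it
    yields \<open>v\<close>, and \<open>m = a + v\<close> is then orthogonal to
    \<open>V\<close>.\<close>
  define V where "V = (\<lambda>y \<sigma>. y \<sigma> - a \<sigma>) ` S"
  have "(\<lambda>\<sigma>. v \<sigma> + c * w \<sigma>) \<in> V" if vw: "v \<in> V" "w \<in> V" for v w c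
  proof -
    obtain y z where yz: "y \<in> S" "z \<in> S" "v = (\<lambda>\<sigma>. y \<sigma> - a \<sigma>)" "w = (\<lambda>\<sigma>. z \<sigma> - a \<sigma>)"
      using vw by (auto simp: V_def)
    then show ?thesis unfolding V_def
      using aff[OF yz(1,2) a, of c]
      by (intro image_eqI[of _ _ "\<lambda>\<sigma>. y \<sigma> + c * (z \<sigma> - a \<sigma>)"]) auto
  qed
  moreover have "\<forall>v\<in>V. \<forall>\<sigma>. \<sigma> \<notin> ?A \<longrightarrow> v \<sigma> = 0"
  proof -
    have "\<forall>y\<in>S. \<forall>\<sigma>. \<sigma> \<notin> ?A \<longrightarrow> y \<sigma> = 0" using S(1) by (auto simp: cochains_def)
    then have "y \<sigma> - a \<sigma> = 0" if "y \<in> S" "\<sigma> \<notin> ?A" for y \<sigma>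
      using a that by (metis diff_self)
    then show ?thesis by (auto simp: V_def simp del: right_minus_eq)
  qed
  moreover have "V \<noteq> {}" using S by (simp add: V_def)
  ultimately obtain v where v: "v \<in> V" "\<forall>w\<in>V. (\<Sum>\<sigma>\<in>?A. (- a \<sigma> - v \<sigma>) * w \<sigma>) = 0"
    using orthogonal_projection_exists[OF fin, of V "\<lambda>\<sigma>. - a \<sigma>"] by auto
  then obtain m where m: "m \<in> S" "v = (\<lambda>\<sigma>. m \<sigma> - a \<sigma>)" by (auto simp: V_def)
  have orth: "(\<Sum>\<sigma>\<in>?A. m \<sigma> * (y \<sigma> - m \<sigma>)) = 0" if "y \<in> S" for y
  proof -
    have yV: "(\<lambda>\<sigma>. y \<sigma> - a \<sigma>) \<in> V" using that by (simp add: V_def)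
    \<comment> \<open>Here \<open>m = - (- a - v)\<close> and \<open>y - m = (y - a) - v\<close>, a
      difference of two elements of \<open>V\<close>.\<close>
    have "(\<Sum>\<sigma>\<in>?A. m \<sigma> * (y \<sigma> - m \<sigma>))
        = (\<Sum>\<sigma>\<in>?A. (- a \<sigma> - v \<sigma>) * v \<sigma> - (- a \<sigma> - v \<sigma>) * (y \<sigma> - a \<sigma>))"
      by (intro sum.cong) (auto simp: m algebra_simps)
    also have "\<dots> = 0" using bspec[OF v(2) v(1)] bspec[OF v(2) yV] by (simp only: sum_subtractf)
    finally show ?thesis .
  qed
  have pyth: "cochain_inner X k y y
      = cochain_inner X k m m + (\<Sum>\<sigma>\<in>?A. (y \<sigma> - m \<sigma>)\<^sup>2)" if "y \<in> S" for y
  proof -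
    have "cochain_inner X k y y
        = (\<Sum>\<sigma>\<in>?A. m \<sigma> * m \<sigma> + 2 * (m \<sigma> * (y \<sigma> - m \<sigma>)) + (y \<sigma> - m \<sigma>)\<^sup>2)"
      unfolding cochain_inner_def
      by (intro sum.cong) (auto simp: algebra_simps power2_eq_square)
    also have "\<dots> = cochain_inner X k m m + 2 * (\<Sum>\<sigma>\<in>?A. m \<sigma> * (y \<sigma> - m \<sigma>))
        + (\<Sum>\<sigma>\<in>?A. (y \<sigma> - m \<sigma>)\<^sup>2)"
      by (simp only: cochain_inner_def sum.distrib sum_distrib_left)
    finally show ?thesis using orth[OF that] by simp
  qed
  have min: "cochain_norm X k m \<le> cochain_norm X k y" if "y \<in> S" for y
    unfolding cochain_norm_def pyth[OF that] by (simp add: sum_nonneg)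
  have uniq: "y = m" if y: "y \<in> S" "cochain_norm X k y \<le> cochain_norm X k m" for y
  proof
    fix \<sigma>
    have "(\<Sum>\<sigma>\<in>?A. (y \<sigma> - m \<sigma>)\<^sup>2) \<le> 0"
      using y(2) unfolding cochain_norm_def pyth[OF y(1)] by simp
    then have "(\<Sum>\<sigma>\<in>?A. (y \<sigma> - m \<sigma>)\<^sup>2) = 0" by (intro antisym sum_nonneg) auto
    then have "\<forall>\<sigma>\<in>?A. y \<sigma> = m \<sigma>" using fin by (simp add: sum_nonneg_eq_0_iff)
    moreover have "y \<in> cochains X k" "m \<in> cochains X k" using y m S by auto
    \<comment> \<open>Off the \<open>k\<close>-simplices both cochains are zero by the extension
      convention, so they agree as total functions.\<close>
    ultimately show "y \<sigma> = m \<sigma>" by (cases "\<sigma> \<in> ?A") (auto simp: cochains_def)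
  qed
  have "arg_min_set (cochain_norm X k) S = {m}"
    using m(1) min uniq by (fastforce simp: arg_min_set_def is_arg_min_linorder)
  then show ?thesis by simp
qed

section \<open>Feasible sets\<close>

text \<open>The complex enters \<open>coboundary\<close> only through the membership test on the
  simplex, and the orientations are shared. Hence \<alpha> may stand unrestricted on the
  right.\<close>

lemma coboundary_restrict:
  assumes "subcomplex K L"
  shows "restrict_cochain K (Suc k) (coboundary ori L k \<alpha>) = coboundary ori K k \<alpha>"
  using assms
  by (auto simp: fun_eq_iff restrict_cochain_def coboundary_def simplices_def subcomplex_def)

text \<open>Since cochains are stored extended by zero, extension by zero from \<open>K\<close> to
  \<open>L\<close> is the identity on functions.\<close>

lemma cochains_subcomplex:
  assumes "subcomplex K L"
  shows "cochains K k \<subseteq> cochains L k"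
  using assms by (auto simp: cochains_def simplices_def subcomplex_def)

lemma restrict_cochain_affine:
  "restrict_cochain K k (\<lambda>\<sigma>. \<alpha> \<sigma> + c * (\<beta> \<sigma> - \<gamma> \<sigma>))
    = (\<lambda>\<sigma>. restrict_cochain K k \<alpha> \<sigma> + c * (restrict_cochain K k \<beta> \<sigma> - restrict_cochain K k \<gamma> \<sigma>))"
  by (auto simp: restrict_cochain_def)

section \<open>Affine closure of cochains, cocycles, coboundaries and cohomology classes\<close>

lemma cochains_affine:
  assumes "\<alpha> \<in> cochains X k" "\<beta> \<in> cochains X k" "\<gamma> \<in> cochains X k"
  shows "(\<lambda>\<sigma>. \<alpha> \<sigma> + c * (\<beta> \<sigma> - \<gamma> \<sigma>)) \<in> cochains X k"
  using assms by (simp add: cochains_def)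

lemma cocycles_affine:
  assumes "\<alpha> \<in> cocycles ori X k" "\<beta> \<in> cocycles ori X k" "\<gamma> \<in> cocycles ori X k"
  shows "(\<lambda>\<sigma>. \<alpha> \<sigma> + c * (\<beta> \<sigma> - \<gamma> \<sigma>)) \<in> cocycles ori X k"
  using assms by (simp add: cocycles_def cochains_affine coboundary_affine)

lemma zero_in_cochains: "(\<lambda>_. 0) \<in> cochains X k"
  by (simp add: cochains_def)

lemma coboundaries_affine:
  assumes "\<alpha> \<in> coboundaries ori X k" "\<beta> \<in> coboundaries ori X k" "\<gamma> \<in> coboundaries ori X k"
  shows "(\<lambda>\<sigma>. \<alpha> \<sigma> + c * (\<beta> \<sigma> - \<gamma> \<sigma>)) \<in> coboundaries ori X k"
proof (cases k)
  case 0
  then show ?thesis using assms by (auto simp: coboundaries_def)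
next
  case (Suc j)
  then obtain a b g where *: "a \<in> cochains X j" "b \<in> cochains X j" "g \<in> cochains X j"
    "\<alpha> = coboundary ori X j a" "\<beta> = coboundary ori X j b" "\<gamma> = coboundary ori X j g"
    using assms by (auto simp: coboundaries_def)
  then show ?thesis
    using imageI[OF cochains_affine[OF *(1-3), of c], of "coboundary ori X j"] Suc
    by (simp add: coboundaries_def coboundary_affine)
qed

lemma cohom_class_affine:
  assumes "x \<in> cohom_class ori X k \<alpha>" "y \<in> cohom_class ori X k \<alpha>" "z \<in> cohom_class ori X k \<alpha>"
  shows "(\<lambda>\<sigma>. x \<sigma> + c * (y \<sigma> - z \<sigma>)) \<in> cohom_class ori X k \<alpha>"
proof -
  \<comment> \<open>The class is a translate of the coboundaries by \<alpha>; in the inner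
    difference the two copies of \<alpha> cancel.\<close>
  have "(\<lambda>\<sigma>. (x \<sigma> - \<alpha> \<sigma>) + c * ((y \<sigma> - \<alpha> \<sigma>) - (z \<sigma> - \<alpha> \<sigma>))) \<in> coboundaries ori X k"
    using assms by (intro coboundaries_affine) (auto simp: cohom_class_def cohomologous_def)
  then have "(\<lambda>\<sigma>. (x \<sigma> + c * (y \<sigma> - z \<sigma>)) - \<alpha> \<sigma>) \<in> coboundaries ori X k"
    by (simp add: algebra_simps)
  then show ?thesis
    using assms by (auto simp: cohom_class_def cohomologous_def intro: cocycles_affine)
qed

lemma zero_in_coboundaries: "(\<lambda>_. 0) \<in> coboundaries ori X k"
  by (cases k)
    (auto simp: coboundaries_def intro!: rev_image_eqI[OF zero_in_cochains] simp: coboundary_zero)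

lemma born_representative_exists:
  assumes KL: "subcomplex K L" and ori: "orientation L ori" and born: "born_between ori K L k \<alpha>"
  shows "\<exists>\<alpha>'\<in>cohom_class ori L k \<alpha>. restrict_cochain K k \<alpha>' = (\<lambda>_. 0)"
proof -
  have L: "finite_simplicial_complex L" using KL by (simp add: subcomplex_def)
  have \<alpha>: "\<alpha> \<in> cocycles ori L k" using born by (simp add: born_between_def)
  have "(\<lambda>_. 0) \<in> cohom_class ori K k (\<lambda>_. 0)"
    using zero_in_coboundaries zero_in_cochains
    by (auto simp: cohom_class_def cohomologous_def cocycles_def coboundary_zero)
  then have "(\<lambda>_. 0) \<in> cohom_class ori K k (restrict_cochain K k \<alpha>)"
    using born by (simp add: born_between_def)
  then have bd: "(\<lambda>\<sigma>. - restrict_cochain K k \<alpha> \<sigma>) \<in> coboundaries ori K k"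
    by (simp add: cohom_class_def cohomologous_def)
  show ?thesis
  proof (cases k)
    \<comment> \<open>In degree 0 the only coboundary is zero, so \<alpha> already vanishes on
      \<open>K\<close> and represents its own class.\<close>
    case 0
    then have "restrict_cochain K k \<alpha> = (\<lambda>_. 0)"
      using bd by (auto simp: coboundaries_def fun_eq_iff)
    moreover have "\<alpha> \<in> cohom_class ori L k \<alpha>"
      using \<alpha> zero_in_coboundaries by (simp add: cohom_class_def cohomologous_def)
    ultimately show ?thesis by blast
  next
    case (Suc j)
    then obtain \<gamma> where \<gamma>: "\<gamma> \<in> cochains K j"
      "(\<lambda>\<sigma>. - restrict_cochain K k \<alpha> \<sigma>) = coboundary ori K j \<gamma>"
      using bd by (auto simp: coboundaries_def)
    let ?d = "coboundary ori L j \<gamma>"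
    have \<gamma>L: "\<gamma> \<in> cochains L j" using \<gamma>(1) cochains_subcomplex[OF KL] by blast
    have d: "?d \<in> cocycles ori L k"
      using coboundary_coboundary[OF L ori] Suc
      by (simp add: cocycles_def coboundary_in_cochains)
    have z: "(\<lambda>_. 0) \<in> cocycles ori L k"
      by (simp add: cocycles_def zero_in_cochains coboundary_zero)
    have "(\<lambda>\<sigma>. \<alpha> \<sigma> + ?d \<sigma>) \<in> cocycles ori L k"
      using cocycles_affine[OF \<alpha> d z, of 1] by simp
    then have cl: "(\<lambda>\<sigma>. \<alpha> \<sigma> + ?d \<sigma>) \<in> cohom_class ori L k \<alpha>"
      using \<alpha> \<gamma>L Suc by (auto simp: cohom_class_def cohomologous_def coboundaries_def)
    have "restrict_cochain K k (\<lambda>\<sigma>. \<alpha> \<sigma> + ?d \<sigma>)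
        = (\<lambda>\<sigma>. restrict_cochain K k \<alpha> \<sigma> + restrict_cochain K k ?d \<sigma>)"
      by (auto simp: restrict_cochain_def)
    \<comment> \<open>\<open>\<gamma>\<close> bounds the negative of the restriction, so the
      correction \<open>?d\<close> is added, and on \<open>K\<close> it cancels \<alpha>.\<close>
    also have "\<dots> = (\<lambda>\<sigma>. restrict_cochain K k \<alpha> \<sigma> + - restrict_cochain K k \<alpha> \<sigma>)"
      using coboundary_restrict[OF KL, of j ori \<gamma>] Suc by (simp flip: \<gamma>(2))
    finally have "restrict_cochain K k (\<lambda>\<sigma>. \<alpha> \<sigma> + ?d \<sigma>) = (\<lambda>_. 0)" by simp
    then show ?thesis using cl by blast
  qed
qed

theorem mainTheorem1:
  fixes K L :: "'a set set" and ori :: "'a set \<Rightarrow> 'a list" and k :: nat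
  assumes "finite_simplicial_complex L" and "subcomplex K L" and "orientation L ori"
  shows
    "(\<forall>\<alpha>. \<alpha> \<in> cocycles ori L k \<longrightarrow> born_between ori K L k \<alpha> \<longrightarrow>
        is_singleton (arg_min_set (cochain_norm L k)
          {\<alpha>' \<in> cochains L k.
             restrict_cochain K k \<alpha>' = (\<lambda>_. 0) \<and> \<alpha>' \<in> cohom_class ori L k \<alpha>}))
     \<and>
     (\<forall>\<beta>. \<beta> \<in> cocycles ori K k \<longrightarrow> dies_between ori K L k \<beta> \<longrightarrow>
        (\<exists>\<omega>.
          arg_min_set (cochain_norm L (Suc k))
            {\<omega>' \<in> cochains L (Suc k).
               \<exists>\<beta>'\<in>cochains L k. restrict_cochain K k \<beta>' = \<beta> \<and> \<omega>' = coboundary ori L k \<beta>'}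
            = {\<omega>} \<and>
          (\<forall>\<beta>h\<in>arg_min_set (\<lambda>\<beta>'. cochain_norm L (Suc k) (coboundary ori L k \<beta>'))
                   {\<beta>' \<in> cochains L k. restrict_cochain K k \<beta>' = \<beta>}.
             coboundary ori L k \<beta>h = \<omega>)))"
proof (intro conjI allI impI)
  note L = assms(1) and KL = assms(2) and ori = assms(3)
  fix \<alpha> assume "born_between ori K L k \<alpha>"
  then obtain \<alpha>' where \<alpha>': "\<alpha>' \<in> cohom_class ori L k \<alpha>" "restrict_cochain K k \<alpha>' = (\<lambda>_. 0)"
    using born_representative_exists[OF KL ori] by blast
  then have "\<alpha>' \<in> cochains L k"
    by (simp add: cohom_class_def cohomologous_def cocycles_def)
  with \<alpha>' show "is_singleton (arg_min_set (cochain_norm L k)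
      {\<alpha>' \<in> cochains L k.
         restrict_cochain K k \<alpha>' = (\<lambda>_. 0) \<and> \<alpha>' \<in> cohom_class ori L k \<alpha>})"
    by (intro affine_arg_min_norm_singleton[OF L])
      (auto simp: cochains_affine cohom_class_affine restrict_cochain_affine)
next
  note L = assms(1) and KL = assms(2)
  fix \<beta> assume \<beta>: "\<beta> \<in> cocycles ori K k"
  let ?B = "{\<beta>' \<in> cochains L k. restrict_cochain K k \<beta>' = \<beta>}"
  let ?S = "{\<omega>' \<in> cochains L (Suc k).
    \<exists>\<beta>'\<in>cochains L k. restrict_cochain K k \<beta>' = \<beta> \<and> \<omega>' = coboundary ori L k \<beta>'}"
  have S: "?S = coboundary ori L k ` ?B"
    using coboundary_in_cochains by blast
  have "\<beta> \<in> cochains K k" using \<beta> by (simp add: cocycles_def)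
  \<comment> \<open>As a function that is zero off \<open>K\<close>, \<beta> is its own extension to
    \<open>L\<close>; this makes \<open>?S\<close> nonempty.\<close>
  then have "\<beta> \<in> ?B"
    using cochains_subcomplex[OF KL] by (auto simp: restrict_cochain_def cochains_def)
  moreover have "(\<lambda>\<sigma>. x \<sigma> + c * (y \<sigma> - z \<sigma>)) \<in> ?S" if "x \<in> ?S" "y \<in> ?S" "z \<in> ?S" for x y z c
  proof -
    obtain p q r where *: "p \<in> ?B" "q \<in> ?B" "r \<in> ?B" "x = coboundary ori L k p"
      "y = coboundary ori L k q" "z = coboundary ori L k r"
      using \<open>x \<in> ?S\<close> \<open>y \<in> ?S\<close> \<open>z \<in> ?S\<close> unfolding S by blast
    \<comment> \<open>The combination is formed on the extensions: its restriction is
      \<open>\<beta> + c * (\<beta> - \<beta>)\<close>, that is \<beta>, and its coboundary is the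
      required combination.\<close>
    have "(\<lambda>\<sigma>. p \<sigma> + c * (q \<sigma> - r \<sigma>)) \<in> ?B"
      using *(1-3) by (simp add: cochains_affine restrict_cochain_affine)
    then show ?thesis
      unfolding S *(4-6) coboundary_affine[symmetric] by (rule imageI)
  qed
  ultimately have "is_singleton (arg_min_set (cochain_norm L (Suc k)) ?S)"
    by (intro affine_arg_min_norm_singleton[OF L]) (use S in blast)+
  then obtain \<omega> where \<omega>: "arg_min_set (cochain_norm L (Suc k)) ?S = {\<omega>}"
    by (auto simp: is_singleton_def)
  moreover have "coboundary ori L k \<beta>h = \<omega>"
    if "\<beta>h \<in> arg_min_set (\<lambda>\<beta>'. cochain_norm L (Suc k) (coboundary ori L k \<beta>')) ?B" for \<beta>h
  proof -
    \<comment> \<open>\<open>?S\<close> is the image of \<open>?B\<close>, so minimizing the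
      composite over \<open>?B\<close> minimizes the norm over \<open>?S\<close>. An extension may
      change by a cocycle vanishing on \<open>K\<close>, but its coboundary is determined.\<close>
    have "coboundary ori L k \<beta>h \<in> arg_min_set (cochain_norm L (Suc k)) ?S"
      using that unfolding S arg_min_set_def is_arg_min_def by blast
    then show ?thesis using \<omega> by simp
  qed
  ultimately show "\<exists>\<omega>. arg_min_set (cochain_norm L (Suc k)) ?S = {\<omega>} \<and>
      (\<forall>\<beta>h\<in>arg_min_set (\<lambda>\<beta>'. cochain_norm L (Suc k) (coboundary ori L k \<beta>')) ?B.
         coboundary ori L k \<beta>h = \<omega>)"
    by blast
qed

end
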